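(* Let $\alpha,\beta\ge 0$ be fixed constants. If $(\omega_i)$ is a sequence of frequencies tending to infinity, then there exists a sequence $(B_i)$ tending to $\frac12$ from below such that, for all but finitely many $i$, the symmetric screw with radius $B_i$ and frequency $\omega_i$ is stationary under the Möbius–Plateau energy with constants $\alpha,\beta$.
   Context: The symmetric screw with radius $B>0$ and frequency $\omega>0$ is the helicoidal strip $\{(r\cos(\omega t),r\sin(\omega t),t): -B\le r\le B,\ t\in\mathbb{R}\}$, bounded by the two helices $\gamma_1(t)=(-B\cos(\omega t),-B\sin(\omega t),t)$ and $\gamma_2(t)=(B\cos(\omega t),B\sin(\omega t),t)$. For fixed constants $\alpha,\beta\ge 0$, the Möbius–Plateau energy of a pair of curves is $\alpha E_M+\beta E_P$, where $E_M(\gamma_1,\gamma_2)=\iint_{\mathbb{R}\times\mathbb{R}}\frac{|\dot\gamma_1(u)||\dot\gamma_2(v)|}{|\gamma_1(u)-\gamma_2(v)|^2}\,du\,dv$ is the Möbius energy and $E_P$ (the Plateau energy) is the area of the minimal surface bounded by the curves. Its stationarity is defined through the gradients, as follows. The Möbius gradient at $\gamma_1(u)$ is $$G_{\gamma_1,\gamma_2}(u)=2\int_{\mathbb{R}}\left[\frac{2P_{\dot\gamma_1(u)^\perp}(\gamma_2(v)-\gamma_1(u))}{|\gamma_2(v)-\gamma_1(u)|^2}-\mathbf{N}_{\gamma_1(u)}\right]\frac{|\dot\gamma_2(v)|\,dv}{|\gamma_2(v)-\gamma_1(u)|^2},$$ where $P_{\dot\gamma_1(u)^\perp}$ is the orthogonal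 projection onto the plane normal to $\dot\gamma_1(u)$ and $\mathbf{N}_{\gamma_1(u)}$ is the Frenet (principal) unit normal of $\gamma_1$; the gradient along $\gamma_2$ is defined by exchanging the roles of the two curves. The Plateau gradient is the unit vector field $\mathbf{n}=\mathbf{T}\times\boldsymbol{\nu}$ along the boundary ($\mathbf{T}$ the unit tangent of the boundary curve, $\boldsymbol{\nu}$ a unit normal of the minimal surface), with the boundary curves oriented oppositely so that $\mathbf{n}$ pulls the surface apart, increasing area; for the symmetric screw, where the minimal surface is the helicoidal strip itself, this is $\mathbf{n}=-(\cos\omega t,\sin\omega t,0)$ at $\gamma_1(t)$ and $\mathbf{n}=(\cos\omega t,\sin\omega t,0)$ at $\gamma_2(t)$. The screw is stationary under the Möbius–Plateau energy if $\alpha G_{\gamma_1,\gamma_2}=-\beta\,\mathbf{n}$ along both boundary curves. For the symmetric screw of radius $B$ and frequency $\omega$ this variational equation reads $$2\alpha\int_{-\infty}^{\infty}\frac{4B(B-1)\cos^2\left(\frac{\omega v}{2}\right)+v^2}{\left(\left(2B\cos\left(\frac{\omega v}{2}\right)\right)^2+v^2\right)^2}\,dv=\frac{-\beta}{\sqrt{\omega^2B^2+1}} .$$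
   Formalization: The constants are additionally assumed to satisfy β = 0 whenever α = 0, because for α = 0 < β the stationarity equation reads 0 = −βn with n a unit vector, so no screw is stationary and the claim as printed fails. *)

theory Defs
  imports "HOL-Analysis.Analysis"
begin

definition unit_tangent :: "(real \<Rightarrow> real^3) \<Rightarrow> real \<Rightarrow> real^3" where
  "unit_tangent \<gamma> t = sgn (vector_derivative \<gamma> (at t))"

definition frenet_normal :: "(real \<Rightarrow> real^3) \<Rightarrow> real \<Rightarrow> real^3" where
  "frenet_normal \<gamma> t = sgn (vector_derivative (unit_tangent \<gamma>) (at t))"

definition proj_perp :: "real^3 \<Rightarrow> real^3 \<Rightarrow> real^3" where
  "proj_perp \<tau> w = w - ((w \<bullet> \<tau>) / (\<tau> \<bullet> \<tau>)) *\<^sub>R \<tau>"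

text \<open>Gradient of the Moebius energy of the pair along its first curve, at \<open>\<gamma>1 u\<close>; the gradient
  along the second curve is \<open>mobius_gradient \<gamma>2 \<gamma>1\<close>. The normal term is the \<^emph>\<open>unit\<close> principal
  normal, not the curvature vector. The Bochner integral is \<open>0\<close> for non-integrable functions,
  but for the boundary of a screw of positive radius the integrand is continuous and
  \<open>O(v\<^sup>-\<^sup>2)\<close>, hence integrable.\<close>

definition mobius_gradient :: "(real \<Rightarrow> real^3) \<Rightarrow> (real \<Rightarrow> real^3) \<Rightarrow> real \<Rightarrow> real^3" where
  "mobius_gradient \<gamma>1 \<gamma>2 u = 2 *\<^sub>R
     (LINT v|lborel.
        (norm (vector_derivative \<gamma>2 (at v)) / (norm (\<gamma>2 v - \<gamma>1 u))\<^sup>2) *\<^sub>R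
        ((2 / (norm (\<gamma>2 v - \<gamma>1 u))\<^sup>2) *\<^sub>R
           proj_perp (vector_derivative \<gamma>1 (at u)) (\<gamma>2 v - \<gamma>1 u)
         - frenet_normal \<gamma>1 u))"

text \<open>Here \<open>n1\<close>, \<open>n2\<close> are the Plateau gradients along \<open>\<gamma>1\<close>, \<open>\<gamma>2\<close>.\<close>

definition mobius_plateau_stationary ::
  "real \<Rightarrow> real \<Rightarrow> (real \<Rightarrow> real^3) \<Rightarrow> (real \<Rightarrow> real^3) \<Rightarrow>
   (real \<Rightarrow> real^3) \<Rightarrow> (real \<Rightarrow> real^3) \<Rightarrow> bool" where
  "mobius_plateau_stationary \<alpha> \<beta> \<gamma>1 \<gamma>2 n1 n2 \<longleftrightarrow>
     (\<forall>u. \<alpha> *\<^sub>R mobius_gradient \<gamma>1 \<gamma>2 u = - (\<beta> *\<^sub>R n1 u)) \<and>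
     (\<forall>u. \<alpha> *\<^sub>R mobius_gradient \<gamma>2 \<gamma>1 u = - (\<beta> *\<^sub>R n2 u))"

text \<open>The symmetric screw of radius \<open>B\<close> and frequency \<open>\<omega>\<close> is the image of \<open>{-B..B} \<times> UNIV\<close> under
  \<open>helicoid \<omega>\<close>; its boundary helices are \<open>helicoid \<omega> (- B)\<close> and \<open>helicoid \<omega> B\<close>.\<close>

definition helicoid :: "real \<Rightarrow> real \<Rightarrow> real \<Rightarrow> real^3" where
  "helicoid \<omega> r t = vector [r * cos (\<omega> * t), r * sin (\<omega> * t), t]"

definition helicoid_normal :: "real \<Rightarrow> real \<Rightarrow> real \<Rightarrow> real^3" where
  "helicoid_normal \<omega> r t =
     sgn (cross3 (vector_derivative (\<lambda>s. helicoid \<omega> s t) (at r))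
                 (vector_derivative (helicoid \<omega> r) (at t)))"

text \<open>The conormal \<open>T \<times> \<nu>\<close>. The two boundary helices are oriented oppositely, the second one in the
  direction of increasing \<open>t\<close>, which makes the conormal point out of the strip on both sides.\<close>

definition screw_plateau_gradient1 :: "real \<Rightarrow> real \<Rightarrow> real \<Rightarrow> real^3" where
  "screw_plateau_gradient1 B \<omega> t =
     cross3 (- unit_tangent (helicoid \<omega> (- B)) t) (helicoid_normal \<omega> (- B) t)"

definition screw_plateau_gradient2 :: "real \<Rightarrow> real \<Rightarrow> real \<Rightarrow> real^3" where
  "screw_plateau_gradient2 B \<omega> t =
     cross3 (unit_tangent (helicoid \<omega> B) t) (helicoid_normal \<omega> B t)"

definition screw_stationary :: "real \<Rightarrow> real \<Rightarrow> real \<Rightarrow> real \<Rightarrow> bool" where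
  "screw_stationary \<alpha> \<beta> B \<omega> \<longleftrightarrow>
     mobius_plateau_stationary \<alpha> \<beta> (helicoid \<omega> (- B)) (helicoid \<omega> B)
       (screw_plateau_gradient1 B \<omega>) (screw_plateau_gradient2 B \<omega>)"

lemma vector_3_eq:
  "(vector [a, b, c] :: real^3) = a *\<^sub>R axis 1 1 + b *\<^sub>R axis 2 1 + c *\<^sub>R axis 3 1"
  by (simp add: vec_eq_iff forall_3 axis_def)

lemma vector_derivative_helicoid_r:
  "vector_derivative (\<lambda>s. helicoid \<omega> s t) (at r) = vector [cos (\<omega> * t), sin (\<omega> * t), 0]"
  by (rule vector_derivative_at)
    (auto simp: helicoid_def vector_3_eq intro!: derivative_eq_intros)

lemma vector_derivative_helicoid_t:
  "vector_derivative (helicoid \<omega> r) (at t) =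
     vector [- (r * \<omega> * sin (\<omega> * t)), r * \<omega> * cos (\<omega> * t), 1]"
  unfolding helicoid_def[abs_def] vector_3_eq
  by (rule vector_derivative_at)
    (auto intro!: derivative_eq_intros simp: algebra_simps has_real_derivative_iff_has_vector_derivative[symmetric])

lemma cross3_tangent_normal:
  fixes x y :: "real^3"
  assumes "x \<bullet> y = 0" "norm x = 1" "y \<noteq> 0"
  shows "cross3 (sgn y) (sgn (cross3 x y)) = x"
proof -
  have "(norm (cross3 x y))\<^sup>2 = (norm y)\<^sup>2"
    using assms norm_cross_dot[of x y] by simp
  then have "norm (cross3 x y) = norm y" by simp
  moreover have "cross3 y (cross3 x y) = (norm y)\<^sup>2 *\<^sub>R x"
    using assms by (simp add: Lagrange inner_commute power2_norm_eq_inner)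
  ultimately show ?thesis
    using assms by (simp add: sgn_div_norm cross_mult_left cross_mult_right power2_eq_square field_simps)
qed

lemma helicoid_conormal:
  "cross3 (unit_tangent (helicoid \<omega> r) t) (helicoid_normal \<omega> r t) =
     vector [cos (\<omega> * t), sin (\<omega> * t), 0]"
  unfolding unit_tangent_def helicoid_normal_def vector_derivative_helicoid_r
    vector_derivative_helicoid_t
  by (rule cross3_tangent_normal)
    (auto simp: inner_vec_def sum_3 norm_vec_def L2_set_def vec_eq_iff forall_3)

lemma screw_plateau_gradient1_eq:
  "screw_plateau_gradient1 B \<omega> t = - vector [cos (\<omega> * t), sin (\<omega> * t), 0]"
  by (simp add: screw_plateau_gradient1_def cross_minus_left helicoid_conormal)

lemma screw_plateau_gradient2_eq:
  "screw_plateau_gradient2 B \<omega> t = vector [cos (\<omega> * t), sin (\<omega> * t), 0]"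
  by (simp add: screw_plateau_gradient2_def helicoid_conormal)

text \<open>With \<open>\<alpha> = 0 < \<beta>\<close> the stationarity equation reads \<open>0 = - \<beta> n\<close>, so no screw is stationary.\<close>

lemma not_screw_stationary_0:
  assumes "\<beta> > 0"
  shows "\<not> screw_stationary 0 \<beta> B \<omega>"
proof
  assume "screw_stationary 0 \<beta> B \<omega>"
  then have "screw_plateau_gradient2 B \<omega> 0 = 0"
    using assms by (simp add: screw_stationary_def mobius_plateau_stationary_def)
  then show False
    by (simp add: screw_plateau_gradient2_eq vec_eq_iff forall_3)
qed

end

theory Submission
  imports Defs "HOL-Probability.Sinc_Integral"
begin

text \<open>
  Put \<open>x = \<omega> (v - u) / 2\<close> and \<open>\<eta> = 1 / (\<omega> B)\<close>. The squared distance from \<open>\<gamma>1 u\<close> to \<open>\<gamma>2 v\<close> is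
  \<open>4 B\<^sup>2 D\<close> with \<open>D = \<eta>\<^sup>2 x\<^sup>2 + cos\<^sup>2 x\<close>. Reflecting \<open>x\<close> to \<open>- x\<close> cancels everything in the
  gradient except its radial part, so that both vector equations reduce to the one scalar
  equation \<open>\<alpha> sqrt (1 + \<eta>\<^sup>2) I + \<beta> B = 0\<close>, where \<open>I\<close> is the integral over the line of
  \<open>(\<eta>\<^sup>2 x\<^sup>2 + (1 - 1/B) cos\<^sup>2 x) / D\<^sup>2\<close> (\<open>screw_stationary_iff\<close>). Write \<open>1 - 1/B = - 1 - \<lambda>\<close>
  with \<open>\<lambda> = 1/B - 2\<close>, which vanishes at \<open>B = 1/2\<close> and is positive below, and let
  \<open>I = P - \<lambda> Q\<close> accordingly, with \<open>Q\<close> the integral of \<open>cos\<^sup>2 x / D\<^sup>2\<close>.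

  The integrand of \<open>P\<close> changes sign, but there is an exact formula: up to the derivative of
  \<open>(sin x cos x + \<eta>\<^sup>2 x) / D\<close> it is a positive multiple of \<open>(\<eta> x cos x / D)\<^sup>2\<close>. Hence \<open>P > 0\<close> for
  every \<open>\<eta>\<close>, and \<open>P = O(1 / \<eta>)\<close> (\<open>gap_integral_critical\<close>). On the other hand each zero of the
  cosine at distance \<open>m\<close> from the origin contributes about \<open>1 / (\<eta> m)\<close> to \<open>Q\<close>, as long as
  \<open>\<eta> m\<close> is small; the harmonic series then gives \<open>\<eta> Q \<rightarrow> \<infinity>\<close> as \<open>\<eta> \<rightarrow> 0\<close>
  (\<open>gap_integral_blowup\<close>).

  Consequently the left-hand side of the scalar equation is positive at \<open>B = 1/2\<close>, and for
  any fixed \<open>b < 1/2\<close> it is negative at \<open>B = b\<close> once \<open>\<omega>\<close> is large. It is continuous in \<open>B\<close>,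
  so it has a zero in \<open>[b, 1/2)\<close> (\<open>screw_stationary_near_half\<close>). Taking \<open>B i\<close> close enough to
  the supremum of the stationary radii for \<open>\<omega> i\<close> gives a sequence tending to \<open>1/2\<close>.
\<close>

section \<open>Integrals against powers of the distance between the helices\<close>

text \<open>The squared distance between points of the two helices, divided by \<open>4 B\<^sup>2\<close>, where \<open>\<eta>\<close> stands
  for \<open>1 / (\<omega> B)\<close> and \<open>x\<close> for half the difference of their angles (see \<open>norm_chord\<close>).\<close>

definition helix_gap :: "real \<Rightarrow> real \<Rightarrow> real" where
  "helix_gap \<eta> x = (\<eta> * x)\<^sup>2 + (cos x)\<^sup>2"

text \<open>Two free coefficients, because the radial gradient at radius \<open>B\<close> has \<open>a = 1\<close>, \<open>b = 1 - 1 / B\<close>,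
  while for fixed \<open>\<eta>\<close> its dependence on \<open>B\<close> is carried by the case \<open>a = 0\<close>, \<open>b = 1\<close>.\<close>

definition gap_integrand :: "real \<Rightarrow> real \<Rightarrow> real \<Rightarrow> real \<Rightarrow> real" where
  "gap_integrand a b \<eta> x = (a * (\<eta> * x)\<^sup>2 + b * (cos x)\<^sup>2) / (helix_gap \<eta> x)\<^sup>2"

definition gap_integral :: "real \<Rightarrow> real \<Rightarrow> real \<Rightarrow> real" where
  "gap_integral a b \<eta> = (LINT x|lborel. gap_integrand a b \<eta> x)"

text \<open>Near the origin the cosine keeps the gap away from \<open>0\<close>, far away the quadratic term does. To
  get both from one estimate, multiply \<open>1 - x\<^sup>2 \<le> cos\<^sup>2 x\<close> by a constant so small that the
  negative term is absorbed by half of \<open>\<eta>\<^sup>2 x\<^sup>2\<close>.\<close>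

lemma helix_gap_lower_bound:
  "min 1 (\<eta>\<^sup>2 / 2) * (1 + x\<^sup>2) \<le> helix_gap \<eta> x"
proof -
  define m where "m = min 1 (\<eta>\<^sup>2 / 2)"
  have m: "0 \<le> m" "m \<le> 1" "m \<le> \<eta>\<^sup>2 / 2"
    by (auto simp: m_def)
  have "(sin x)\<^sup>2 \<le> x\<^sup>2"
    using abs_sin_x_le_abs_x[of x] by (simp add: abs_le_square_iff)
  then have "1 - x\<^sup>2 \<le> (cos x)\<^sup>2"
    by (simp add: cos_squared_eq)
  then have "m * (1 - x\<^sup>2) \<le> m * (cos x)\<^sup>2"
    using m by (intro mult_left_mono)
  also have "\<dots> \<le> 1 * (cos x)\<^sup>2"
    using m by (intro mult_right_mono) auto
  finally have "m * (1 - x\<^sup>2) \<le> (cos x)\<^sup>2"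
    by simp
  moreover have "2 * m * x\<^sup>2 \<le> \<eta>\<^sup>2 * x\<^sup>2"
    using m by (intro mult_right_mono) auto
  ultimately show ?thesis
    unfolding m_def[symmetric] helix_gap_def by (simp add: power_mult_distrib algebra_simps)
qed

lemma helix_gap_pos:
  assumes "\<eta> > 0"
  shows "helix_gap \<eta> x > 0"
proof -
  have "0 < min 1 (\<eta>\<^sup>2 / 2) * (1 + x\<^sup>2)"
    using assms by (intro mult_pos_pos) (auto simp: add_pos_nonneg)
  then show ?thesis
    using helix_gap_lower_bound[of \<eta> x] by linarith
qed

lemma inverse_helix_gap_bound:
  assumes "\<eta> > 0"
  shows "1 / helix_gap \<eta> x \<le> (1 / min 1 (\<eta>\<^sup>2 / 2)) * inverse (1 + x\<^sup>2)"
proof -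
  have "0 < min 1 (\<eta>\<^sup>2 / 2) * (1 + x\<^sup>2)"
    using assms by (intro mult_pos_pos) (auto simp: add_pos_nonneg)
  from frac_le[OF _ _ this helix_gap_lower_bound, of 1 1] show ?thesis
    by (simp only: divide_inverse inverse_mult_distrib mult_1_left zero_le_one order_refl)
qed

lemma integrable_inverse_1_plus_square_lborel:
  "integrable lborel (\<lambda>x::real. inverse (1 + x\<^sup>2))"
  using integrable_inverse_1_plus_square
  unfolding set_integrable_def einterval_eq_UNIV by simp

lemma integral_inverse_1_plus_square_lborel:
  "(LINT x|lborel. inverse (1 + x\<^sup>2 :: real)) = pi"
  using LBINT_inverse_1_plus_square
  unfolding interval_lebesgue_integral_def set_lebesgue_integral_def einterval_eq_UNIV by simp

text \<open>The only integrability criterion used below: \<open>1 / helix_gap \<eta>\<close> decays like \<open>1 / (1 + x\<^sup>2)\<close>.\<close>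

lemma integrable_of_gap_bound:
  fixes f :: "real \<Rightarrow> 'a::{banach,second_countable_topology}"
  assumes "\<eta> > 0" and "f \<in> borel_measurable borel"
    and "\<And>x. norm (f x) \<le> C / helix_gap \<eta> x"
  shows "integrable lborel f"
proof (rule Bochner_Integration.integrable_bound)
  show "integrable lborel (\<lambda>x. \<bar>C\<bar> * ((1 / min 1 (\<eta>\<^sup>2 / 2)) * inverse (1 + x\<^sup>2)))"
    by (intro integrable_mult_right integrable_inverse_1_plus_square_lborel)
  show "f \<in> borel_measurable lborel"
    using assms by simp
  show "AE x in lborel. norm (f x) \<le> norm (\<bar>C\<bar> * ((1 / min 1 (\<eta>\<^sup>2 / 2)) * inverse (1 + x\<^sup>2)))"
  proof (rule AE_I2)
    fix x :: real
    have "norm (f x) \<le> C / helix_gap \<eta> x"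
      using assms by blast
    also have "\<dots> \<le> \<bar>C\<bar> * (1 / helix_gap \<eta> x)"
      using helix_gap_pos[OF assms(1), of x] by (simp add: divide_right_mono)
    also have "\<dots> \<le> \<bar>C\<bar> * ((1 / min 1 (\<eta>\<^sup>2 / 2)) * inverse (1 + x\<^sup>2))"
      by (intro mult_left_mono inverse_helix_gap_bound assms) auto
    finally show "norm (f x) \<le> norm (\<bar>C\<bar> * ((1 / min 1 (\<eta>\<^sup>2 / 2)) * inverse (1 + x\<^sup>2)))"
      by simp
  qed
qed

lemma borel_measurable_helix_gap [measurable]: "helix_gap \<eta> \<in> borel_measurable borel"
  unfolding helix_gap_def[abs_def] by measurable

lemma borel_measurable_gap_integrand [measurable]: "gap_integrand a b \<eta> \<in> borel_measurable borel"
  unfolding gap_integrand_def[abs_def] by measurable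

lemma gap_integrand_bound:
  assumes "\<eta> > 0"
  shows "\<bar>gap_integrand a b \<eta> x\<bar> \<le> (\<bar>a\<bar> + \<bar>b\<bar>) / helix_gap \<eta> x"
proof -
  have "\<bar>a * (\<eta> * x)\<^sup>2 + b * (cos x)\<^sup>2\<bar> \<le> \<bar>a\<bar> * (\<eta> * x)\<^sup>2 + \<bar>b\<bar> * (cos x)\<^sup>2"
    by (rule order_trans[OF abs_triangle_ineq]) (simp add: abs_mult)
  also have "\<dots> \<le> \<bar>a\<bar> * helix_gap \<eta> x + \<bar>b\<bar> * helix_gap \<eta> x"
    by (intro add_mono mult_left_mono) (auto simp: helix_gap_def)
  finally have "\<bar>a * (\<eta> * x)\<^sup>2 + b * (cos x)\<^sup>2\<bar> \<le> (\<bar>a\<bar> + \<bar>b\<bar>) * helix_gap \<eta> x"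
    by (simp add: algebra_simps)
  then show ?thesis
    using helix_gap_pos[OF assms, of x]
    by (simp add: gap_integrand_def abs_divide field_simps power2_eq_square)
qed

lemma integrable_gap_integrand:
  assumes "\<eta> > 0"
  shows "integrable lborel (gap_integrand a b \<eta>)"
  using assms gap_integrand_bound[OF assms] by (intro integrable_of_gap_bound[OF assms]) auto

lemma gap_integral_split:
  assumes "\<eta> > 0"
  shows "gap_integral a (b + c) \<eta> = gap_integral a b \<eta> + c * gap_integral 0 1 \<eta>"
proof -
  have "gap_integrand a (b + c) \<eta> = (\<lambda>x. gap_integrand a b \<eta> x + c * gap_integrand 0 1 \<eta> x)"
    by (rule ext) (simp add: gap_integrand_def add_divide_distrib distrib_right)
  then show ?thesis
    using integrable_gap_integrand[OF assms] by (simp add: gap_integral_def)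
qed

text \<open>The gap increases with \<open>\<eta>\<close>, so for arguments above \<open>\<eta> / 2\<close> all integrands are dominated by a
  multiple of \<open>1 / helix_gap (\<eta> / 2)\<close>.\<close>

lemma continuous_on_gap_integral: "continuous_on {0<..} (gap_integral a b)"
  unfolding continuous_on_sequentially comp_def
proof safe
  fix X :: "nat \<Rightarrow> real" and \<eta> :: real
  assume X: "\<forall>n. X n \<in> {0<..}" and \<eta>: "0 < \<eta>" and lim: "X \<longlonglongrightarrow> \<eta>"
  obtain N where N: "\<And>n. n \<ge> N \<Longrightarrow> X n > \<eta> / 2"
    using order_tendstoD(1)[OF lim, of "\<eta> / 2"] \<eta> by (auto simp: eventually_sequentially)
  have "(\<lambda>n. gap_integral a b (X (n + N))) \<longlonglongrightarrow> gap_integral a b \<eta>"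
    unfolding gap_integral_def
  proof (rule integral_dominated_convergence)
    show "integrable lborel (\<lambda>x. (\<bar>a\<bar> + \<bar>b\<bar>) / helix_gap (\<eta> / 2) x)"
    proof (rule integrable_of_gap_bound)
      show "norm ((\<bar>a\<bar> + \<bar>b\<bar>) / helix_gap (\<eta> / 2) x) \<le> (\<bar>a\<bar> + \<bar>b\<bar>) / helix_gap (\<eta> / 2) x" for x
        using helix_gap_pos[of "\<eta> / 2" x] \<eta> by simp
    qed (use \<eta> in auto)
    show "AE x in lborel. (\<lambda>n. gap_integrand a b (X (n + N)) x) \<longlonglongrightarrow> gap_integrand a b \<eta> x"
    proof (rule AE_I2)
      fix x :: real
      have "(\<lambda>n. X (n + N)) \<longlonglongrightarrow> \<eta>"
        using lim by (rule LIMSEQ_ignore_initial_segment)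
      moreover have "helix_gap \<eta> x \<noteq> 0"
        using helix_gap_pos[of \<eta> x] \<eta> by simp
      ultimately show "(\<lambda>n. gap_integrand a b (X (n + N)) x) \<longlonglongrightarrow> gap_integrand a b \<eta> x"
        unfolding gap_integrand_def helix_gap_def by (intro tendsto_intros) auto
    qed
    show "AE x in lborel. norm (gap_integrand a b (X (n + N)) x) \<le> (\<bar>a\<bar> + \<bar>b\<bar>) / helix_gap (\<eta> / 2) x" for n
    proof (rule AE_I2)
      fix x :: real
      have X': "X (n + N) > \<eta> / 2"
        using N by simp
      have "(\<eta> / 2)\<^sup>2 * x\<^sup>2 \<le> (X (n + N))\<^sup>2 * x\<^sup>2"
        using X' \<eta> by (intro mult_right_mono power_mono) auto
      then have le: "helix_gap (\<eta> / 2) x \<le> helix_gap (X (n + N)) x"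
        by (simp add: helix_gap_def power_mult_distrib power_divide)
      have "norm (gap_integrand a b (X (n + N)) x) \<le> (\<bar>a\<bar> + \<bar>b\<bar>) / helix_gap (X (n + N)) x"
        using gap_integrand_bound X by auto
      also have "\<dots> \<le> (\<bar>a\<bar> + \<bar>b\<bar>) / helix_gap (\<eta> / 2) x"
        using le helix_gap_pos[of "\<eta> / 2" x] \<eta> by (intro divide_left_mono mult_pos_pos) auto
      finally show "norm (gap_integrand a b (X (n + N)) x) \<le> (\<bar>a\<bar> + \<bar>b\<bar>) / helix_gap (\<eta> / 2) x" .
    qed
  qed auto
  then show "(\<lambda>n. gap_integral a b (X n)) \<longlonglongrightarrow> gap_integral a b \<eta>"
    by (rule LIMSEQ_offset)
qed

section \<open>Positivity at the critical radius\<close>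

text \<open>The nonnegative function that replaces the oscillating integrand at the critical radius
  \<open>B = 1/2\<close>, once an exact derivative is removed.\<close>

definition cross_integrand :: "real \<Rightarrow> real \<Rightarrow> real" where
  "cross_integrand \<eta> x = ((\<eta> * x) * cos x / helix_gap \<eta> x)\<^sup>2"

text \<open>With \<open>p = (\<eta> x)\<^sup>2\<close> and \<open>c = cos\<^sup>2 x \<le> 1\<close> this is \<open>p c (1 + p) \<le> (p + c)\<^sup>2\<close>, whose two sides differ
  by \<open>p c + p\<^sup>2 (1 - c) + c\<^sup>2\<close>. A bound in \<open>\<eta> x\<close> alone yields the rate \<open>1 / \<eta>\<close> after rescaling.\<close>

lemma cross_integrand_bound:
  assumes "\<eta> > 0"
  shows "cross_integrand \<eta> x \<le> inverse (1 + (\<eta> * x)\<^sup>2)"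
proof -
  define p c where "p = (\<eta> * x)\<^sup>2" and "c = (cos x)\<^sup>2"
  have pc: "0 \<le> p" "0 \<le> c" "c \<le> 1"
    by (auto simp: p_def c_def power_le_one_iff abs_square_le_1)
  have "0 < helix_gap \<eta> x"
    using helix_gap_pos[OF assms] .
  then have pos: "0 < (p + c)\<^sup>2"
    unfolding helix_gap_def p_def c_def by (rule zero_less_power)
  have "0 \<le> p * c + p\<^sup>2 * (1 - c) + c\<^sup>2"
    using pc by simp
  then have "p * c * (1 + p) \<le> (p + c)\<^sup>2"
    by (simp add: power2_eq_square algebra_simps)
  then have "p * c / (p + c)\<^sup>2 \<le> inverse (1 + p)"
    using pos pc by (simp add: pos_divide_le_eq inverse_eq_divide pos_le_divide_eq mult.commute)
  then show ?thesis
    by (simp add: cross_integrand_def p_def c_def helix_gap_def power_mult_distrib power_divide)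
qed

lemma cross_integrand_le:
  assumes "\<eta> > 0"
  shows "cross_integrand \<eta> x \<le> 1 / helix_gap \<eta> x"
proof -
  have "helix_gap \<eta> x \<le> 1 + (\<eta> * x)\<^sup>2"
    by (simp add: helix_gap_def abs_square_le_1)
  then have "inverse (1 + (\<eta> * x)\<^sup>2) \<le> 1 / helix_gap \<eta> x"
    using helix_gap_pos[OF assms, of x] by (simp add: field_simps)
  then show ?thesis
    using cross_integrand_bound[OF assms, of x] by linarith
qed

lemma borel_measurable_cross_integrand [measurable]: "cross_integrand \<eta> \<in> borel_measurable borel"
  unfolding cross_integrand_def[abs_def] by measurable

lemma integrable_cross_integrand:
  assumes "\<eta> > 0"
  shows "integrable lborel (cross_integrand \<eta>)"
proof (rule integrable_of_gap_bound[OF assms])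
  show "norm (cross_integrand \<eta> x) \<le> 1 / helix_gap \<eta> x" for x
    using cross_integrand_le[OF assms, of x] by (simp add: cross_integrand_def)
qed simp

lemma integral_cross_integrand_le:
  assumes "\<eta> > 0"
  shows "(LINT x|lborel. cross_integrand \<eta> x) \<le> pi / \<eta>"
proof -
  have int: "integrable lborel (\<lambda>x. inverse (1 + (\<eta> * x)\<^sup>2))"
    using lborel_integrable_real_affine[OF integrable_inverse_1_plus_square_lborel, of \<eta> 0] assms
    by simp
  have "pi = \<eta> * (LINT x|lborel. inverse (1 + (\<eta> * x)\<^sup>2))"
    using lborel_integral_real_affine[of \<eta> "\<lambda>x. inverse (1 + x\<^sup>2)" 0] assms
      integral_inverse_1_plus_square_lborel by simp
  then have "(LINT x|lborel. inverse (1 + (\<eta> * x)\<^sup>2)) = pi / \<eta>"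
    using assms by (simp add: field_simps)
  then show ?thesis
    using integral_mono[OF integrable_cross_integrand[OF assms] int] cross_integrand_bound[OF assms]
    by simp
qed

lemma integral_cross_integrand_pos:
  assumes "\<eta> > 0"
  shows "0 < (LINT x|lborel. cross_integrand \<eta> x)"
proof (rule ccontr)
  assume "\<not> 0 < (LINT x|lborel. cross_integrand \<eta> x)"
  moreover have "0 \<le> (LINT x|lborel. cross_integrand \<eta> x)"
    by (intro integral_nonneg_AE) (simp add: cross_integrand_def)
  ultimately have "(LINT x|lborel. cross_integrand \<eta> x) = 0"
    by simp
  then have "AE x in lborel. cross_integrand \<eta> x = 0"
    using integrable_cross_integrand[OF assms]
    by (subst (asm) integral_nonneg_eq_0_iff_AE) (auto simp: cross_integrand_def)
  then have "AE x in lborel. x \<notin> {0<..<1::real}"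
  proof eventually_elim
    case (elim x)
    show ?case
    proof
      assume "x \<in> {0<..<1}"
      then have "cos x > 0"
        using pi_gt3 by (intro cos_gt_zero) auto
      then show False
        using elim \<open>x \<in> {0<..<1}\<close> assms helix_gap_pos[OF assms, of x]
        by (simp add: cross_integrand_def)
    qed
  qed
  then have "emeasure lborel {0<..<1::real} = 0"
    by (subst (asm) AE_iff_measurable[where N = "{0<..<1}"]) auto
  then show False
    by simp
qed

text \<open>The identity behind the sign at the critical radius. For constant \<open>p\<close>, differentiating
  \<open>sin x cos x / (p\<^sup>2 + cos\<^sup>2 x)\<close> gives \<open>(cos\<^sup>2 x - p\<^sup>2 + 2 p\<^sup>2 cos\<^sup>2 x) / (p\<^sup>2 + cos\<^sup>2 x)\<^sup>2\<close>. Substituting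
  \<open>p = \<eta> x\<close> creates an additional term of indefinite sign, a multiple of
  \<open>x sin x cos x / (helix_gap \<eta> x)\<^sup>2\<close>; the same term appears when \<open>x / helix_gap \<eta> x\<close> is
  differentiated, and the summand \<open>\<eta>\<^sup>2 x\<close> in the numerator is chosen to cancel it.\<close>

lemma gap_primitive_deriv:
  assumes "\<eta> > 0"
  shows "((\<lambda>x. (sin x * cos x + \<eta>\<^sup>2 * x) / helix_gap \<eta> x) has_real_derivative
           2 * cross_integrand \<eta> x - (1 + \<eta>\<^sup>2) * gap_integrand 1 (- 1) \<eta> x) (at x)"
proof -
  define s c where "s = sin x" and "c = cos x"
  have sc: "s\<^sup>2 = 1 - c\<^sup>2"
    by (simp add: s_def c_def sin_squared_eq)
  have pos: "0 < (\<eta> * x)\<^sup>2 + c\<^sup>2"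
    using helix_gap_pos[OF assms, of x] by (simp add: helix_gap_def c_def)
  have gap': "(helix_gap \<eta> has_real_derivative 2 * \<eta>\<^sup>2 * x - 2 * c * s) (at x)"
    unfolding helix_gap_def[abs_def] s_def c_def
    by (auto intro!: derivative_eq_intros simp: power2_eq_square algebra_simps)
  have num': "((\<lambda>x. sin x * cos x + \<eta>\<^sup>2 * x) has_real_derivative c\<^sup>2 - s\<^sup>2 + \<eta>\<^sup>2) (at x)"
    unfolding s_def c_def
    by (auto intro!: derivative_eq_intros simp: power2_eq_square algebra_simps)
  have eq: "(c\<^sup>2 - s\<^sup>2 + \<eta>\<^sup>2) * ((\<eta> * x)\<^sup>2 + c\<^sup>2) - (s * c + \<eta>\<^sup>2 * x) * (2 * \<eta>\<^sup>2 * x - 2 * c * s)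
      = 2 * ((\<eta> * x) * c)\<^sup>2 - (1 + \<eta>\<^sup>2) * ((\<eta> * x)\<^sup>2 - c\<^sup>2)"
    using sc by algebra
  have "((\<lambda>x. (sin x * cos x + \<eta>\<^sup>2 * x) / helix_gap \<eta> x) has_real_derivative
      ((c\<^sup>2 - s\<^sup>2 + \<eta>\<^sup>2) * helix_gap \<eta> x - (s * c + \<eta>\<^sup>2 * x) * (2 * \<eta>\<^sup>2 * x - 2 * c * s))
        / (helix_gap \<eta> x * helix_gap \<eta> x)) (at x)"
    using DERIV_divide[OF num' gap'] helix_gap_pos[OF assms, of x] by (simp add: s_def c_def)
  moreover have "((c\<^sup>2 - s\<^sup>2 + \<eta>\<^sup>2) * helix_gap \<eta> x - (s * c + \<eta>\<^sup>2 * x) * (2 * \<eta>\<^sup>2 * x - 2 * c * s))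
        / (helix_gap \<eta> x * helix_gap \<eta> x)
      = 2 * cross_integrand \<eta> x - (1 + \<eta>\<^sup>2) * gap_integrand 1 (- 1) \<eta> x"
    using eq unfolding helix_gap_def cross_integrand_def gap_integrand_def c_def[symmetric]
    by (simp add: power_divide diff_divide_distrib[symmetric] power2_eq_square)
  ultimately show ?thesis
    by simp
qed

lemma filterlim_abs_at_bot: "filterlim (abs :: real \<Rightarrow> real) at_top at_bot"
  using filterlim_compose[OF filterlim_abs_real filterlim_uminus_at_top_at_bot] by simp

lemma gap_primitive_tendsto_0:
  assumes "\<eta> > 0" and F: "filterlim (\<lambda>x::real. \<bar>x\<bar>) at_top F"
  shows "((\<lambda>x. (sin x * cos x + \<eta>\<^sup>2 * x) / helix_gap \<eta> x) \<longlongrightarrow> 0) F"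
proof (rule Lim_null_comparison)
  show "((\<lambda>x. (1 + \<eta>\<^sup>2) * inverse (\<eta>\<^sup>2 * \<bar>x\<bar>)) \<longlongrightarrow> 0) F"
    using assms(1)
    by (intro tendsto_mult_right_zero tendsto_inverse_0_at_top
        filterlim_tendsto_pos_mult_at_top[OF tendsto_const _ F]) simp
  have "\<forall>\<^sub>F x::real in F. \<bar>x\<bar> \<ge> 1"
    using F by (auto simp: filterlim_at_top)
  then show "\<forall>\<^sub>F x in F. norm ((sin x * cos x + \<eta>\<^sup>2 * x) / helix_gap \<eta> x)
      \<le> (1 + \<eta>\<^sup>2) * inverse (\<eta>\<^sup>2 * \<bar>x\<bar>)"
  proof eventually_elim
    case (elim x)
    have "\<bar>sin x * cos x\<bar> \<le> 1 * 1"
      unfolding abs_mult by (intro mult_mono) auto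
    then have "\<bar>sin x * cos x + \<eta>\<^sup>2 * x\<bar> \<le> \<bar>x\<bar> + \<eta>\<^sup>2 * \<bar>x\<bar>"
      using elim by (intro order_trans[OF abs_triangle_ineq]) (simp add: abs_mult)
    then have num: "\<bar>sin x * cos x + \<eta>\<^sup>2 * x\<bar> \<le> (1 + \<eta>\<^sup>2) * \<bar>x\<bar>"
      by (simp add: algebra_simps)
    have "norm ((sin x * cos x + \<eta>\<^sup>2 * x) / helix_gap \<eta> x) \<le> ((1 + \<eta>\<^sup>2) * \<bar>x\<bar>) / (\<eta>\<^sup>2 * \<bar>x\<bar>\<^sup>2)"
      unfolding real_norm_def abs_divide
      using num elim assms(1) by (intro frac_le) (auto simp: helix_gap_def power_mult_distrib)
    also have "\<dots> = (1 + \<eta>\<^sup>2) * inverse (\<eta>\<^sup>2 * \<bar>x\<bar>)"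
      using elim assms(1) by (auto simp: field_simps power2_eq_square)
    finally show ?case .
  qed
qed

lemma isCont_gap_integrand:
  assumes "\<eta> > 0"
  shows "isCont (gap_integrand a b \<eta>) x"
  using helix_gap_pos[OF assms, of x]
  unfolding gap_integrand_def[abs_def] helix_gap_def[abs_def] by (auto intro!: continuous_intros)

lemma isCont_cross_integrand:
  assumes "\<eta> > 0"
  shows "isCont (cross_integrand \<eta>) x"
  using helix_gap_pos[OF assms, of x]
  unfolding cross_integrand_def[abs_def] helix_gap_def[abs_def] by (auto intro!: continuous_intros)

text \<open>Integrate \<open>gap_primitive_deriv\<close> over the line; the primitive vanishes at both ends.\<close>

lemma gap_integral_critical:
  assumes "\<eta> > 0"
  shows "gap_integral 1 (- 1) \<eta> = 2 / (1 + \<eta>\<^sup>2) * (LINT x|lborel. cross_integrand \<eta> x)"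
proof -
  let ?f = "\<lambda>x. 2 * cross_integrand \<eta> x - (1 + \<eta>\<^sup>2) * gap_integrand 1 (- 1) \<eta> x"
  have int: "integrable lborel ?f"
    using integrable_gap_integrand[OF assms] integrable_cross_integrand[OF assms] by simp
  have "(LBINT x=-\<infinity>..\<infinity>. ?f x) = 0 - 0"
  proof (rule interval_integral_FTC_integrable)
    show "set_integrable lborel (einterval (-\<infinity>) \<infinity>) ?f"
      using int by (simp add: set_integrable_def einterval_eq_UNIV)
    show "isCont ?f x" for x
      using isCont_gap_integrand[OF assms] isCont_cross_integrand[OF assms]
      by (intro continuous_intros) auto
    show "((\<lambda>x. (sin x * cos x + \<eta>\<^sup>2 * x) / helix_gap \<eta> x) has_vector_derivative ?f x) (at x)" for x
      using gap_primitive_deriv[OF assms]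
      by (simp add: has_real_derivative_iff_has_vector_derivative)
    show "(((\<lambda>x. (sin x * cos x + \<eta>\<^sup>2 * x) / helix_gap \<eta> x) \<circ> real_of_ereal) \<longlongrightarrow> 0) (at_right (-\<infinity>))"
      unfolding ereal_tendsto_simps
      by (rule gap_primitive_tendsto_0[OF assms filterlim_abs_at_bot])
    show "(((\<lambda>x. (sin x * cos x + \<eta>\<^sup>2 * x) / helix_gap \<eta> x) \<circ> real_of_ereal) \<longlongrightarrow> 0) (at_left \<infinity>)"
      unfolding ereal_tendsto_simps
      by (rule gap_primitive_tendsto_0[OF assms filterlim_abs_real])
  qed simp
  then have "(LINT x|lborel. ?f x) = 0"
    by (simp add: interval_lebesgue_integral_def set_lebesgue_integral_def einterval_eq_UNIV)
  then have "2 * (LINT x|lborel. cross_integrand \<eta> x) = (1 + \<eta>\<^sup>2) * gap_integral 1 (- 1) \<eta>"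
    using integrable_gap_integrand[OF assms] integrable_cross_integrand[OF assms]
    by (simp add: gap_integral_def)
  then show ?thesis
    by (simp add: field_simps add_pos_nonneg power2_eq_square add_nonneg_eq_0_iff)
qed

lemma gap_integral_critical_pos:
  assumes "\<eta> > 0"
  shows "0 < gap_integral 1 (- 1) \<eta>"
  using integral_cross_integrand_pos[OF assms]
  unfolding gap_integral_critical[OF assms]
  by (intro mult_pos_pos divide_pos_pos) (auto simp: add_pos_nonneg)

lemma gap_integral_critical_le:
  assumes "\<eta> > 0"
  shows "gap_integral 1 (- 1) \<eta> \<le> 2 * pi / \<eta>"
proof -
  have "gap_integral 1 (- 1) \<eta> \<le> 2 / 1 * (pi / \<eta>)"
    unfolding gap_integral_critical[OF assms]
    using integral_cross_integrand_pos[OF assms]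
    by (intro mult_mono divide_left_mono integral_cross_integrand_le assms) (auto simp: add_pos_nonneg)
  then show ?thesis
    by simp
qed

section \<open>Logarithmic divergence at the zeros of the cosine\<close>

text \<open>The cosine is at least \<open>1/2\<close> on \<open>[0, \<pi>/3]\<close>, which contains \<open>[0, 1]\<close>.\<close>

lemma half_le_sin:
  fixes s :: real
  assumes "0 \<le> s" "s \<le> 1"
  shows "s / 2 \<le> sin s"
proof -
  have "(\<lambda>t. sin t - t / 2) 0 \<le> (\<lambda>t. sin t - t / 2) s"
  proof (rule DERIV_nonneg_imp_nondecreasing[OF assms(1)])
    fix t assume t: "0 \<le> t" "t \<le> s"
    have "cos (pi / 3) \<le> cos t"
      using t assms pi_gt3 by (intro cos_monotone_0_pi_le) auto
    then show "\<exists>y. ((\<lambda>t. sin t - t / 2) has_real_derivative y) (at t) \<and> 0 \<le> y"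
      by (intro exI[of _ "cos t - 1 / 2"]) (auto intro!: derivative_eq_intros simp: cos_60)
  qed
  then show ?thesis
    by simp
qed

lemma cos_at_zero_add: "\<bar>cos ((real n + 1 / 2) * pi + s)\<bar> = \<bar>sin s\<bar>"
proof -
  have "(real n + 1 / 2) * pi + s = real n * pi + (s + pi / 2)"
    by (simp add: algebra_simps)
  then have "cos ((real n + 1 / 2) * pi + s) = (- 1) ^ n * cos (s + pi / 2)"
    by (simp only: cos_add cos_npi sin_npi)
  then show ?thesis
    by (simp add: abs_mult cos_add)
qed

text \<open>At distance \<open>s\<close> from the zero \<open>m\<close> of the cosine, \<open>cos\<^sup>2 x\<close> is comparable to \<open>s\<^sup>2\<close> and the other
  part of the gap is comparable to \<open>(\<eta> m)\<^sup>2\<close>. For \<open>s\<close> between \<open>\<eta> m\<close> and \<open>2 \<eta> m\<close> the two balance and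
  the integrand has size \<open>1 / (\<eta> m)\<^sup>2\<close>.\<close>

lemma gap_integrand_near_cos_zero:
  fixes n :: nat
  defines "m \<equiv> (real n + 1 / 2) * pi"
  assumes \<eta>: "0 < \<eta>" "2 * \<eta> * m \<le> 1" and x: "x \<in> {m + \<eta> * m .. m + 2 * \<eta> * m}"
  shows "1 / (256 * (\<eta> * m)\<^sup>2) \<le> gap_integrand 0 1 \<eta> x"
proof -
  define s where "s = x - m"
  define t where "t = \<eta> * m"
  have m1: "1 \<le> m"
  proof -
    have "1 \<le> (1 / 2) * pi" using pi_ge_two by simp
    also have "\<dots> \<le> m" unfolding m_def by (intro mult_right_mono) auto
    finally show ?thesis .
  qed
  have t: "0 < t" "2 * t \<le> 1"
    using \<eta> m1 by (auto simp: t_def)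
  have s: "t \<le> s" "s \<le> 2 * t"
    using x by (auto simp: s_def t_def)
  have sin_s: "t / 2 \<le> sin s" "sin s \<le> 2 * t"
    using half_le_sin[of s] sin_x_le_x[of s] s t by auto
  have "\<bar>cos x\<bar> = \<bar>sin s\<bar>"
    using cos_at_zero_add[of n s] by (simp add: s_def m_def)
  then have cos_eq: "(cos x)\<^sup>2 = (sin s)\<^sup>2"
    by (metis power2_abs)
  have cos_lower: "(t / 2)\<^sup>2 \<le> (cos x)\<^sup>2"
    unfolding cos_eq using sin_s t by (intro power_mono) auto
  have cos_upper: "(cos x)\<^sup>2 \<le> (2 * t)\<^sup>2"
    unfolding cos_eq using sin_s t by (intro power_mono) auto
  have "2 * \<eta> * 1 \<le> 2 * \<eta> * m"
    using \<eta> m1 by (intro mult_left_mono) auto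
  then have "2 * \<eta> \<le> 1"
    using \<eta>(2) by linarith
  then have "2 * \<eta> * m \<le> 1 * m"
    using m1 by (intro mult_right_mono) auto
  then have "x \<le> 2 * m" and "0 \<le> x"
    using x m1 \<eta> by auto
  then have "\<eta> * x \<le> 2 * t" "0 \<le> \<eta> * x"
    using \<eta> by (auto simp: t_def)
  then have "(\<eta> * x)\<^sup>2 \<le> (2 * t)\<^sup>2"
    by (intro power_mono)
  then have gap: "helix_gap \<eta> x \<le> 8 * t\<^sup>2"
    using cos_upper by (simp add: helix_gap_def power_mult_distrib)
  have gap_sq: "(helix_gap \<eta> x)\<^sup>2 \<le> (8 * t\<^sup>2)\<^sup>2"
    using gap helix_gap_pos[OF \<eta>(1), of x] by (intro power_mono) auto
  have "1 / (256 * t\<^sup>2) = (t / 2)\<^sup>2 / (8 * t\<^sup>2)\<^sup>2"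
    using t by (simp add: power2_eq_square field_simps)
  also have "\<dots> \<le> (cos x)\<^sup>2 / (helix_gap \<eta> x)\<^sup>2"
    using helix_gap_pos[OF \<eta>(1), of x] by (intro frac_le cos_lower gap_sq) auto
  finally show ?thesis
    by (simp add: gap_integrand_def t_def)
qed

text \<open>An interval of length \<open>\<eta> m\<close> behind each zero \<open>m\<close> contributes at least \<open>1 / (256 \<eta> m)\<close>, and the
  zeros grow linearly. The bound on \<open>\<eta>\<close> makes the first \<open>N\<close> of these intervals so short that they
  are disjoint.\<close>

lemma harm_le_gap_integral:
  assumes \<eta>: "0 < \<eta>" "8 * \<eta> * (real N + 1) \<le> 1"
  shows "harm N / 1024 \<le> \<eta> * gap_integral 0 1 \<eta>"
proof -
  define m where "m n = (real n + 1 / 2) * pi" for n :: nat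
  define A where "A n = {m n + \<eta> * m n .. m n + 2 * \<eta> * m n}" for n
  have m_pos: "0 < m n" for n
    by (simp add: m_def)
  have m_le: "m n \<le> 4 * (real n + 1)" for n
    unfolding m_def using pi_less_4 by (subst mult.commute, intro mult_mono) auto
  have small: "2 * \<eta> * m n \<le> 1" if "n < N" for n
  proof -
    have "2 * \<eta> * m n \<le> 2 * \<eta> * (4 * (real N + 1))"
      using that \<eta> m_le[of n] by (intro mult_left_mono) auto
    also have "\<dots> = 8 * \<eta> * (real N + 1)"
      by simp
    finally show ?thesis
      using \<eta>(2) by linarith
  qed
  have disj: "disjoint_family_on A {..<N}"
    unfolding disjoint_family_on_def
  proof (intro ballI impI)
    have less: "A i \<inter> A j = {}" if "i < j" "i < N" for i j
    proof -
      have "m i + pi \<le> m j"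
      proof -
        have "(real i + 1 / 2 + 1) * pi \<le> (real j + 1 / 2) * pi"
          using that by (intro mult_right_mono) auto
        then show ?thesis
          by (simp add: m_def algebra_simps)
      qed
      moreover have "0 < \<eta> * m j"
        using \<eta> m_pos by simp
      ultimately have "m i + 2 * \<eta> * m i < m j + \<eta> * m j"
        using small[OF that(2)] pi_gt3 by linarith
      then show ?thesis
        by (auto simp: A_def)
    qed
    fix i j assume "i \<in> {..<N}" "j \<in> {..<N}" "i \<noteq> j"
    then show "A i \<inter> A j = {}"
      using less[of i j] less[of j i] by (cases "i < j") auto
  qed
  have fin: "emeasure lborel (A n) < \<infinity>" for n
    by (simp add: A_def emeasure_lborel_Icc_eq)
  have len: "measure lborel (A n) = \<eta> * m n" for n
    using \<eta> m_pos[of n] by (simp add: A_def)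
  let ?f = "\<lambda>x. \<Sum>n<N. 1 / (256 * (\<eta> * m n)\<^sup>2) * indicator (A n) x"
  have "?f x \<le> gap_integrand 0 1 \<eta> x" for x
  proof (cases "\<exists>k<N. x \<in> A k")
    case True
    then obtain k where k: "k < N" "x \<in> A k" by blast
    then have "?f x = 1 / (256 * (\<eta> * m k)\<^sup>2)"
      by (intro sum_indicator_disjoint_family[OF disj]) auto
    also have "\<dots> \<le> gap_integrand 0 1 \<eta> x"
      using gap_integrand_near_cos_zero[of \<eta> k x] k small[OF k(1)] \<eta>(1)
      by (simp add: m_def A_def)
    finally show ?thesis .
  next
    case False
    then have "?f x = 0"
      by (intro sum.neutral) auto
    then show ?thesis
      by (simp add: gap_integrand_def)
  qed
  then have "(LINT x|lborel. ?f x) \<le> gap_integral 0 1 \<eta>"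
    unfolding gap_integral_def using fin
    by (intro integral_mono integrable_gap_integrand \<eta>(1) Bochner_Integration.integrable_sum
        integrable_mult_right integrable_real_indicator) (auto simp: A_def)
  moreover have "(LINT x|lborel. ?f x) = (\<Sum>n<N. 1 / (256 * (\<eta> * m n)\<^sup>2) * (\<eta> * m n))"
    using fin len
    by (subst Bochner_Integration.integral_sum)
      (auto simp: A_def intro!: integrable_mult_right integrable_real_indicator)
  ultimately have "\<eta> * (\<Sum>n<N. 1 / (256 * (\<eta> * m n)\<^sup>2) * (\<eta> * m n)) \<le> \<eta> * gap_integral 0 1 \<eta>"
    using \<eta> by simp
  moreover have "harm N / 1024 \<le> \<eta> * (\<Sum>n<N. 1 / (256 * (\<eta> * m n)\<^sup>2) * (\<eta> * m n))"
  proof -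
    have "harm N / 1024 = (\<Sum>n<N. 1 / (1024 * (real n + 1)))"
      unfolding harm_altdef sum_divide_distrib
      by (intro sum.cong) (auto simp: divide_simps)
    also have "\<dots> \<le> (\<Sum>n<N. \<eta> * (1 / (256 * (\<eta> * m n)\<^sup>2) * (\<eta> * m n)))"
    proof (rule sum_mono)
      fix n
      have "\<eta> * (1 / (256 * (\<eta> * m n)\<^sup>2) * (\<eta> * m n)) = 1 / (256 * m n)"
        using \<eta> m_pos[of n] by (simp add: power2_eq_square)
      moreover have "1 / (1024 * (real n + 1)) \<le> 1 / (256 * m n)"
        using m_le[of n] m_pos[of n] by (intro frac_le) auto
      ultimately show "1 / (1024 * (real n + 1)) \<le> \<eta> * (1 / (256 * (\<eta> * m n)\<^sup>2) * (\<eta> * m n))"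
        by simp
    qed
    finally show ?thesis
      by (simp add: sum_distrib_left)
  qed
  ultimately show ?thesis
    by linarith
qed

lemma gap_integral_blowup:
  "filterlim (\<lambda>\<eta>. \<eta> * gap_integral 0 1 \<eta>) at_top (at_right 0)"
  unfolding filterlim_at_top
proof
  fix K :: real
  obtain N where N: "1024 * K \<le> harm N"
    using harm_at_top unfolding filterlim_at_top eventually_sequentially by blast
  show "\<forall>\<^sub>F \<eta> in at_right 0. K \<le> \<eta> * gap_integral 0 1 \<eta>"
    unfolding eventually_at_right_field
  proof (intro exI conjI allI impI)
    show "0 < 1 / (8 * (real N + 1))"
      by simp
    fix \<eta> :: real assume "0 < \<eta>" "\<eta> < 1 / (8 * (real N + 1))"
    then have "harm N / 1024 \<le> \<eta> * gap_integral 0 1 \<eta>"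
      by (intro harm_le_gap_integral) (auto simp: field_simps)
    then show "K \<le> \<eta> * gap_integral 0 1 \<eta>"
      using N by linarith
  qed
qed

section \<open>The gradient along the boundary helices\<close>

text \<open>The outward radial unit vector at \<open>helicoid \<omega> r t\<close> for \<open>r > 0\<close>.\<close>

definition radial :: "real \<Rightarrow> real \<Rightarrow> real^3" where
  "radial \<omega> t = vector [cos (\<omega> * t), sin (\<omega> * t), 0]"

lemma norm_vector_3: "(norm (vector [a, b, c] :: real^3))\<^sup>2 = a\<^sup>2 + b\<^sup>2 + c\<^sup>2"
  unfolding power2_norm_eq_inner by (simp add: inner_vec_def sum_3 power2_eq_square)

lemma norm_radial: "norm (radial \<omega> t) = 1"
proof -
  have "(norm (radial \<omega> t))\<^sup>2 = 1\<^sup>2"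
    by (simp add: radial_def norm_vector_3)
  then show ?thesis
    by (simp only: power2_eq_iff_nonneg norm_ge_zero zero_le_one)
qed

lemma norm_vector_derivative_helicoid:
  "norm (vector_derivative (helicoid \<omega> r) (at t)) = sqrt (1 + (\<omega> * r)\<^sup>2)"
proof -
  have "(r * \<omega> * sin (\<omega> * t))\<^sup>2 + (r * \<omega> * cos (\<omega> * t))\<^sup>2 = (\<omega> * r)\<^sup>2 * ((sin (\<omega> * t))\<^sup>2 + (cos (\<omega> * t))\<^sup>2)"
    by algebra
  then have "(norm (vector_derivative (helicoid \<omega> r) (at t)))\<^sup>2 = 1 + (\<omega> * r)\<^sup>2"
    by (simp add: vector_derivative_helicoid_t norm_vector_3)
  then show ?thesis
    by (metis norm_ge_zero real_sqrt_abs abs_of_nonneg)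
qed

text \<open>The factor \<open>- sgn r\<close> makes the normal point to the axis for either sign of \<open>r\<close>, so that one
  computation serves both boundary helices.\<close>

lemma frenet_normal_helicoid:
  assumes "\<omega> \<noteq> 0"
  shows "frenet_normal (helicoid \<omega> r) t = - sgn r *\<^sub>R radial \<omega> t"
proof -
  define k where "k = 1 / sqrt (1 + (\<omega> * r)\<^sup>2)"
  have k: "k > 0"
    by (simp add: k_def add_pos_nonneg)
  have norm_velocity: "norm (vector [- (r * \<omega> * sin (\<omega> * t)), r * \<omega> * cos (\<omega> * t), 1] :: real^3)
      = sqrt (1 + (\<omega> * r)\<^sup>2)" for t
    using norm_vector_derivative_helicoid[of \<omega> r t] by (simp only: vector_derivative_helicoid_t)
  have "unit_tangent (helicoid \<omega> r) = (\<lambda>t. k *\<^sub>R vector [- (r * \<omega> * sin (\<omega> * t)), r * \<omega> * cos (\<omega> * t), 1])"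
    by (rule ext)
      (simp add: unit_tangent_def sgn_div_norm norm_velocity k_def
        vector_derivative_helicoid_t inverse_eq_divide)
  moreover have "((\<lambda>t. k *\<^sub>R (vector [- (r * \<omega> * sin (\<omega> * t)), r * \<omega> * cos (\<omega> * t), 1] :: real^3))
      has_vector_derivative (- k * \<omega>\<^sup>2 * r) *\<^sub>R radial \<omega> t) (at t)"
    unfolding vector_3_eq radial_def
    by (auto intro!: derivative_eq_intros
        simp: algebra_simps power2_eq_square has_real_derivative_iff_has_vector_derivative[symmetric])
  ultimately have "vector_derivative (unit_tangent (helicoid \<omega> r)) (at t) = (- k * \<omega>\<^sup>2 * r) *\<^sub>R radial \<omega> t"
    by (simp add: vector_derivative_at)
  moreover have "sgn (k * \<omega>\<^sup>2 * r) = sgn r"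
    unfolding sgn_mult[of "k * \<omega>\<^sup>2" r] using k assms by (simp add: sgn_pos)
  moreover have "sgn (radial \<omega> t) = radial \<omega> t"
    by (simp add: sgn_div_norm norm_radial)
  ultimately show ?thesis
    by (simp add: frenet_normal_def sgn_scaleR sgn_minus)
qed

lemma proj_perp_add: "proj_perp \<tau> (v + w) = proj_perp \<tau> v + proj_perp \<tau> w"
  by (simp add: proj_perp_def inner_add_left add_divide_distrib scaleR_add_left)

lemma proj_perp_orthogonal: "v \<bullet> \<tau> = 0 \<Longrightarrow> proj_perp \<tau> v = v"
  by (simp add: proj_perp_def)

lemma norm_proj_perp_le: "norm (proj_perp \<tau> w) \<le> norm w"
proof -
  have "proj_perp \<tau> w \<bullet> proj_perp \<tau> w = w \<bullet> w - (w \<bullet> \<tau>)\<^sup>2 / (\<tau> \<bullet> \<tau>)"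
    by (cases "\<tau> = 0")
      (auto simp: proj_perp_def inner_diff_left inner_diff_right inner_commute power2_eq_square divide_simps
        simp del: inner_eq_zero_iff)
  also have "\<dots> \<le> w \<bullet> w"
    by simp
  finally show ?thesis
    by (simp add: norm_le)
qed

text \<open>The chord from one helix to the other, with the endpoint parametrised by half the angle
  difference.\<close>

definition chord :: "real \<Rightarrow> real \<Rightarrow> real \<Rightarrow> real \<Rightarrow> real^3" where
  "chord \<omega> r u x = helicoid \<omega> (- r) (u + 2 / \<omega> * x) - helicoid \<omega> r u"

text \<open>By the sum-to-product formulas, the horizontal part points in the bisecting direction.\<close>

lemma chord_eq:
  assumes "\<omega> \<noteq> 0"
  shows "chord \<omega> r u x = (- 2 * r * cos x) *\<^sub>R vector [cos (\<omega> * u + x), sin (\<omega> * u + x), 0]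
    + (2 / \<omega> * x) *\<^sub>R vector [0, 0, 1]"
proof -
  have arg: "\<omega> * (u + 2 * x / \<omega>) = 2 * x + \<omega> * u"
    using assms by (simp add: field_simps)
  have "cos (\<omega> * u + x + x) + cos (\<omega> * u) = 2 * cos x * cos (\<omega> * u + x)"
    using cos_times_cos[of x "\<omega> * u + x"] by (simp add: algebra_simps)
  moreover have "sin (\<omega> * u + x + x) + sin (\<omega> * u) = 2 * cos x * sin (\<omega> * u + x)"
    using sin_times_cos[of "\<omega> * u + x" x] by (simp add: algebra_simps)
  ultimately have
    "- r * cos (\<omega> * u + x + x) - r * cos (\<omega> * u) = - 2 * r * cos x * cos (\<omega> * u + x)"
    "- r * sin (\<omega> * u + x + x) - r * sin (\<omega> * u) = - 2 * r * cos x * sin (\<omega> * u + x)"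
    by algebra+
  then show ?thesis
    by (simp add: chord_def helicoid_def arg vec_eq_iff forall_3)
qed

lemma norm_chord:
  assumes "\<omega> \<noteq> 0" "r \<noteq> 0"
  shows "(norm (chord \<omega> r u x))\<^sup>2 = 4 * r\<^sup>2 * helix_gap (1 / (\<omega> * \<bar>r\<bar>)) x"
proof -
  have eq: "chord \<omega> r u x = vector [- 2 * r * cos x * cos (\<omega> * u + x), - 2 * r * cos x * sin (\<omega> * u + x), 2 / \<omega> * x]"
    by (simp add: chord_eq[OF assms(1)] vec_eq_iff forall_3)
  have "(norm (chord \<omega> r u x))\<^sup>2
      = (2 * r * cos x)\<^sup>2 * ((cos (\<omega> * u + x))\<^sup>2 + (sin (\<omega> * u + x))\<^sup>2) + (2 / \<omega> * x)\<^sup>2"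
    unfolding eq norm_vector_3 by algebra
  also have "\<dots> = 4 * r\<^sup>2 * helix_gap (1 / (\<omega> * \<bar>r\<bar>)) x"
    using assms by (simp add: helix_gap_def power_mult_distrib power_divide field_simps)
  finally show ?thesis .
qed

text \<open>Reflecting \<open>x\<close> to \<open>- x\<close> amounts to the rotation by \<open>\<pi>\<close> about the radial line through the base
  point, which exchanges the two directions along each helix; the components of the chord
  orthogonal to this line are odd in \<open>x\<close>.\<close>

lemma chord_reflect_sum:
  assumes "\<omega> \<noteq> 0"
  shows "chord \<omega> r u x + chord \<omega> r u (- x) = (- 4 * r * (cos x)\<^sup>2) *\<^sub>R radial \<omega> u"
proof -
  have "cos (\<omega> * u + x) + cos (\<omega> * u - x) = 2 * cos x * cos (\<omega> * u)"
    "sin (\<omega> * u + x) + sin (\<omega> * u - x) = 2 * cos x * sin (\<omega> * u)"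
    by (simp_all add: cos_add cos_diff sin_add sin_diff)
  then have
    "- 2 * r * cos x * cos (\<omega> * u + x) + - 2 * r * cos x * cos (\<omega> * u - x) = - 4 * r * (cos x)\<^sup>2 * cos (\<omega> * u)"
    "- 2 * r * cos x * sin (\<omega> * u + x) + - 2 * r * cos x * sin (\<omega> * u - x) = - 4 * r * (cos x)\<^sup>2 * sin (\<omega> * u)"
    by algebra+
  then show ?thesis
    by (simp add: chord_eq[OF assms] radial_def vec_eq_iff forall_3)
qed

text \<open>Averaging the integrand over \<open>x\<close> and \<open>- x\<close> leaves only a radial vector, which is orthogonal to the
  tangent, so that the projection acts on it as the identity. What remains is a scalar integral.\<close>

lemma mobius_gradient_helices:
  assumes \<omega>: "\<omega> > 0" and r: "r \<noteq> 0"
  defines "\<eta> \<equiv> 1 / (\<omega> * \<bar>r\<bar>)"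
  shows "mobius_gradient (helicoid \<omega> r) (helicoid \<omega> (- r)) u =
    (sgn r * sqrt (1 + \<eta>\<^sup>2) / \<bar>r\<bar> * gap_integral 1 (1 - 1 / \<bar>r\<bar>) \<eta>) *\<^sub>R radial \<omega> u"
proof -
  define \<tau> where "\<tau> = vector_derivative (helicoid \<omega> r) (at u)"
  define L where "L = sqrt (1 + (\<omega> * r)\<^sup>2)"
  define D where "D x = 4 * r\<^sup>2 * helix_gap \<eta> x" for x
  define F where "F v = (norm (vector_derivative (helicoid \<omega> (- r)) (at v)) / (norm (helicoid \<omega> (- r) v - helicoid \<omega> r u))\<^sup>2) *\<^sub>R
        ((2 / (norm (helicoid \<omega> (- r) v - helicoid \<omega> r u))\<^sup>2) *\<^sub>R
           proj_perp \<tau> (helicoid \<omega> (- r) v - helicoid \<omega> r u)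
         - frenet_normal (helicoid \<omega> r) u)" for v
  define G where "G x = (L / D x) *\<^sub>R ((2 / D x) *\<^sub>R proj_perp \<tau> (chord \<omega> r u x) + sgn r *\<^sub>R radial \<omega> u)" for x
  have \<eta>: "\<eta> > 0"
    using \<omega> r by (simp add: \<eta>_def)
  have L: "L > 0"
    by (simp add: L_def add_pos_nonneg)
  have D_pos: "D x > 0" for x
    using r helix_gap_pos[OF \<eta>, of x] by (simp add: D_def)
  have D_minus: "D (- x) = D x" for x
    by (simp add: D_def helix_gap_def)
  have norm_chord_D: "(norm (chord \<omega> r u x))\<^sup>2 = D x" for x
    using norm_chord[of \<omega> r u x] \<omega> r by (simp add: D_def \<eta>_def)
  have FG: "F (u + 2 / \<omega> * x) = G x" for x
    using \<omega> norm_chord_D[of x]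
    by (simp add: F_def G_def chord_def norm_vector_derivative_helicoid frenet_normal_helicoid L_def)
  have int_G: "integrable lborel G"
  proof (rule integrable_of_gap_bound[OF \<eta>])
    show "G \<in> borel_measurable borel"
      unfolding G_def[abs_def] D_def chord_def helicoid_def vector_3_eq proj_perp_def by measurable
    define m where "m = min 1 (\<eta>\<^sup>2 / 2)"
    have m: "m > 0"
      using \<eta> by (simp add: m_def)
    show "norm (G x) \<le> (L / (4 * r\<^sup>2) * (2 / sqrt (4 * r\<^sup>2 * m) + 1)) / helix_gap \<eta> x" for x
    proof -
      have "m \<le> helix_gap \<eta> x"
        using helix_gap_lower_bound[of \<eta> x] m
        by (smt (verit) m_def mult_le_cancel_left1 zero_le_power2)
      then have "4 * r\<^sup>2 * m \<le> D x"
        by (simp add: D_def mult_left_mono)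
      then have sqrt_le: "sqrt (4 * r\<^sup>2 * m) \<le> sqrt (D x)"
        by simp
      have sqrt_pos: "0 < sqrt (4 * r\<^sup>2 * m)"
        using r m by simp
      have "norm (chord \<omega> r u x) = sqrt (D x)"
        using norm_chord_D[of x] by (metis norm_ge_zero real_sqrt_abs abs_of_nonneg)
      then have "norm ((2 / D x) *\<^sub>R proj_perp \<tau> (chord \<omega> r u x)) \<le> 2 / D x * sqrt (D x)"
        using norm_proj_perp_le[of \<tau> "chord \<omega> r u x"] D_pos[of x]
        by (simp add: divide_right_mono)
      also have "\<dots> = 2 / sqrt (D x)"
        using D_pos[of x] by (simp add: field_simps)
      also have "\<dots> \<le> 2 / sqrt (4 * r\<^sup>2 * m)"
        using sqrt_le sqrt_pos D_pos[of x] by (intro divide_left_mono mult_pos_pos) auto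
      finally have "norm ((2 / D x) *\<^sub>R proj_perp \<tau> (chord \<omega> r u x)) \<le> 2 / sqrt (4 * r\<^sup>2 * m)" .
      moreover have "norm (sgn r *\<^sub>R radial \<omega> u) = 1"
        using r by (simp add: norm_radial abs_sgn_eq)
      ultimately have "norm ((2 / D x) *\<^sub>R proj_perp \<tau> (chord \<omega> r u x) + sgn r *\<^sub>R radial \<omega> u)
          \<le> 2 / sqrt (4 * r\<^sup>2 * m) + 1"
        using norm_triangle_ineq[of "(2 / D x) *\<^sub>R proj_perp \<tau> (chord \<omega> r u x)" "sgn r *\<^sub>R radial \<omega> u"]
        by linarith
      then have "norm (G x) \<le> L / D x * (2 / sqrt (4 * r\<^sup>2 * m) + 1)"
        using L D_pos[of x] unfolding G_def norm_scaleR by (intro mult_mono) auto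
      then show ?thesis
        by (simp add: D_def)
    qed
  qed
  have sum_G: "G x + G (- x) = (sgn r * L / (2 * r\<^sup>2) * gap_integrand 1 (1 - 1 / \<bar>r\<bar>) \<eta> x) *\<^sub>R radial \<omega> u" for x
  proof -
    have orth: "((- 4 * r * (cos x)\<^sup>2) *\<^sub>R radial \<omega> u) \<bullet> \<tau> = 0"
      by (simp add: \<tau>_def radial_def vector_derivative_helicoid_t inner_vec_def sum_3)
    have "proj_perp \<tau> (chord \<omega> r u x) + proj_perp \<tau> (chord \<omega> r u (- x)) = (- 4 * r * (cos x)\<^sup>2) *\<^sub>R radial \<omega> u"
      using chord_reflect_sum[of \<omega> r u x] \<omega> proj_perp_orthogonal[OF orth]
      by (simp add: proj_perp_add[symmetric])
    moreover have "G x + G (- x) = (L / D x) *\<^sub>R ((2 / D x) *\<^sub>R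
        (proj_perp \<tau> (chord \<omega> r u x) + proj_perp \<tau> (chord \<omega> r u (- x))) + (2 * sgn r) *\<^sub>R radial \<omega> u)"
      by (simp only: G_def D_minus mult_2 scaleR_add_left scaleR_add_right add_ac)
    ultimately have "G x + G (- x)
        = (L / D x * (2 / D x * (- 4 * r * (cos x)\<^sup>2) + 2 * sgn r)) *\<^sub>R radial \<omega> u"
      by (simp only: scaleR_add_left scaleR_add_right scaleR_scaleR distrib_left mult.assoc)
    moreover have "L / D x * (2 / D x * (- 4 * r * (cos x)\<^sup>2) + 2 * sgn r)
        = sgn r * L / (2 * r\<^sup>2) * gap_integrand 1 (1 - 1 / \<bar>r\<bar>) \<eta> x"
    proof -
      define g where "g = helix_gap \<eta> x"
      have g: "g > 0" "(\<eta> * x)\<^sup>2 = g - (cos x)\<^sup>2"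
        using helix_gap_pos[OF \<eta>, of x] by (auto simp: g_def helix_gap_def)
      have D: "D x = 4 * \<bar>r\<bar>\<^sup>2 * g"
        by (simp add: D_def g_def)
      have "r = sgn r * \<bar>r\<bar>"
        by (simp add: sgn_mult_abs)
      then have "L / D x * (2 / D x * (- 4 * r * (cos x)\<^sup>2) + 2 * sgn r)
          = sgn r * (L / D x * (2 / D x * (- 4 * \<bar>r\<bar> * (cos x)\<^sup>2) + 2))"
        by (simp add: algebra_simps)
      also have "L / D x * (2 / D x * (- 4 * \<bar>r\<bar> * (cos x)\<^sup>2) + 2)
          = L / (2 * \<bar>r\<bar>\<^sup>2) * ((g - (cos x)\<^sup>2 + (1 - 1 / \<bar>r\<bar>) * (cos x)\<^sup>2) / g\<^sup>2)"
        using g r unfolding D by (simp add: divide_simps) (simp add: power2_eq_square algebra_simps)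
      finally show ?thesis
        by (simp add: gap_integrand_def g(2) g_def)
    qed
    ultimately show ?thesis
      by simp
  qed
  \<comment> \<open>Reflection preserves Lebesgue measure, so the integral of \<open>G\<close> is half that of its symmetrisation.\<close>
  have refl: "(LINT x|lborel. G (- x)) = (LINT x|lborel. G x)"
    using lborel_integral_real_affine[of "- 1" G 0] by simp
  have "2 *\<^sub>R (LINT x|lborel. G x) = (LINT x|lborel. G x + G (- x))"
    using int_G lborel_integrable_real_affine[OF int_G, of "- 1" 0] refl by (simp add: scaleR_2)
  also have "\<dots> = (sgn r * L / (2 * r\<^sup>2) * gap_integral 1 (1 - 1 / \<bar>r\<bar>) \<eta>) *\<^sub>R radial \<omega> u"
    unfolding sum_G gap_integral_def using integrable_gap_integrand[OF \<eta>] by simp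
  finally have G_eq: "2 *\<^sub>R (LINT x|lborel. G x) = (sgn r * L / (2 * r\<^sup>2) * gap_integral 1 (1 - 1 / \<bar>r\<bar>) \<eta>) *\<^sub>R radial \<omega> u" .
  have "L = sqrt ((\<omega> * \<bar>r\<bar>)\<^sup>2 * (1 + \<eta>\<^sup>2))"
    using \<omega> r by (simp add: L_def \<eta>_def power_mult_distrib power_divide field_simps)
  then have L_eq: "L = \<omega> * \<bar>r\<bar> * sqrt (1 + \<eta>\<^sup>2)"
    using \<omega> by (simp add: real_sqrt_mult)
  have "mobius_gradient (helicoid \<omega> r) (helicoid \<omega> (- r)) u = 2 *\<^sub>R (LINT v|lborel. F v)"
    by (simp add: mobius_gradient_def F_def \<tau>_def)
  also have "(LINT v|lborel. F v) = (2 / \<omega>) *\<^sub>R (LINT x|lborel. G x)"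
    using lborel_integral_real_affine[of "2 / \<omega>" F u] \<omega> unfolding FG by simp
  also have "2 *\<^sub>R (2 / \<omega>) *\<^sub>R (LINT x|lborel. G x) = (2 / \<omega>) *\<^sub>R 2 *\<^sub>R (LINT x|lborel. G x)"
    by (simp add: mult.commute)
  also have "\<dots> = (2 / \<omega> * (sgn r * L / (2 * r\<^sup>2) * gap_integral 1 (1 - 1 / \<bar>r\<bar>) \<eta>)) *\<^sub>R radial \<omega> u"
    by (simp only: G_eq scaleR_scaleR)
  also have "2 / \<omega> * (sgn r * L / (2 * r\<^sup>2) * gap_integral 1 (1 - 1 / \<bar>r\<bar>) \<eta>)
      = sgn r * sqrt (1 + \<eta>\<^sup>2) / \<bar>r\<bar> * gap_integral 1 (1 - 1 / \<bar>r\<bar>) \<eta>"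
  proof -
    have "2 / \<omega> * (s * (\<omega> * a * q) / (2 * a\<^sup>2) * i) = s * q / a * i" if "a > 0" for s a q i :: real
      using that \<omega> by (simp add: field_simps power2_eq_square)
    from this[of "\<bar>r\<bar>"] show ?thesis
      using r unfolding L_eq by simp
  qed
  finally show ?thesis .
qed

text \<open>Along both helices the Moebius and the Plateau gradients are multiples of the same radial unit
  vector. Passing from one helix to the other reverses both signs, so the two vector equations
  are the same scalar equation.\<close>

lemma screw_stationary_iff:
  assumes \<omega>: "\<omega> > 0" and B: "B > 0"
  defines "\<eta> \<equiv> 1 / (\<omega> * B)"
  shows "screw_stationary \<alpha> \<beta> B \<omega> \<longleftrightarrow>
    \<alpha> * sqrt (1 + \<eta>\<^sup>2) * gap_integral 1 (1 - 1 / B) \<eta> + \<beta> * B = 0"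
proof -
  define M where "M = sqrt (1 + \<eta>\<^sup>2) / B * gap_integral 1 (1 - 1 / B) \<eta>"
  have grad1: "mobius_gradient (helicoid \<omega> (- B)) (helicoid \<omega> B) u = - M *\<^sub>R radial \<omega> u" for u
    using mobius_gradient_helices[OF \<omega>, of "- B" u] B by (simp add: \<eta>_def M_def)
  have grad2: "mobius_gradient (helicoid \<omega> B) (helicoid \<omega> (- B)) u = M *\<^sub>R radial \<omega> u" for u
    using mobius_gradient_helices[OF \<omega>, of B u] B by (simp add: \<eta>_def M_def)
  have nz: "radial \<omega> u \<noteq> 0" for u
    using norm_radial[of \<omega> u] by auto
  have "\<alpha> *\<^sub>R (M *\<^sub>R radial \<omega> u) = - (\<beta> *\<^sub>R radial \<omega> u) \<longleftrightarrow> \<alpha> * M = - \<beta>" for u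
    using nz[of u] scaleR_cancel_right[of "\<alpha> * M" "radial \<omega> u" "- \<beta>"] by simp
  moreover have "\<alpha> *\<^sub>R (- M *\<^sub>R radial \<omega> u) = - (\<beta> *\<^sub>R (- radial \<omega> u)) \<longleftrightarrow> \<alpha> * M = - \<beta>" for u
    using nz[of u] scaleR_cancel_right[of "- (\<alpha> * M)" "radial \<omega> u" "\<beta>"] by auto
  ultimately have "screw_stationary \<alpha> \<beta> B \<omega> \<longleftrightarrow> \<alpha> * M = - \<beta>"
    unfolding screw_stationary_def mobius_plateau_stationary_def grad1 grad2
      screw_plateau_gradient1_eq screw_plateau_gradient2_eq radial_def[symmetric]
    by simp
  also have "\<dots> \<longleftrightarrow> \<alpha> * sqrt (1 + \<eta>\<^sup>2) * gap_integral 1 (1 - 1 / B) \<eta> + \<beta> * B = 0"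
    using B by (auto simp: M_def field_simps)
  finally show ?thesis .
qed

section \<open>Stationary radii close to one half\<close>

text \<open>After multiplication by \<open>\<eta>\<close>, the critical part of the integral is at most \<open>2 \<pi>\<close>, while the part with
  the negative coefficient \<open>2 - 1 / b\<close> blows up as \<open>\<eta> \<rightarrow> 0\<close>.\<close>

lemma scalar_equation_lhs_eventually_neg:
  assumes b: "0 < b" "b < 1 / 2" and \<alpha>: "\<alpha> > 0" and \<beta>: "\<beta> \<ge> 0"
  shows "\<forall>\<^sub>F w in at_top.
    \<alpha> * sqrt (1 + (1 / (w * b))\<^sup>2) * gap_integral 1 (1 - 1 / b) (1 / (w * b)) + \<beta> * b < 0"
proof -
  define l where "l = 1 / b - 2"
  have l: "l > 0"
    using b by (simp add: l_def field_simps)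
  have small: "filterlim (\<lambda>w. 1 / (w * b)) (at_right 0) at_top"
    using b
    by (auto simp: filterlim_at eventually_at_top_dense filterlim_at_top_mult_tendsto_pos[OF tendsto_const _ filterlim_ident]
        intro!: tendsto_divide_0[OF tendsto_const] filterlim_at_top_imp_at_infinity exI[of _ 0])
  have "\<forall>\<^sub>F \<eta> in at_right (0 :: real). \<eta> \<in> {0<..<1}"
    by (rule eventually_at_right_real) simp
  \<comment> \<open>This threshold leaves \<open>I \<le> - (\<beta> / \<alpha> + 1) / \<eta>\<close>, enough to outweigh \<open>\<beta> b\<close> when \<open>\<eta> < 1\<close>.\<close>
  moreover have "\<forall>\<^sub>F \<eta> in at_right 0. (2 * pi + \<beta> / \<alpha> + 1) / l \<le> \<eta> * gap_integral 0 1 \<eta>"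
    using gap_integral_blowup by (simp add: filterlim_at_top)
  ultimately have "\<forall>\<^sub>F \<eta> in at_right 0. \<alpha> * sqrt (1 + \<eta>\<^sup>2) * gap_integral 1 (1 - 1 / b) \<eta> + \<beta> * b < 0"
  proof eventually_elim
    case (elim \<eta>)
    then have \<eta>: "0 < \<eta>" "\<eta> < 1"
      by auto
    have "gap_integral 1 (1 - 1 / b) \<eta> = gap_integral 1 (- 1) \<eta> - l * gap_integral 0 1 \<eta>"
      using gap_integral_split[OF \<eta>(1), of 1 "- 1" "- l"] by (simp add: l_def algebra_simps)
    then have "\<eta> * gap_integral 1 (1 - 1 / b) \<eta>
        = \<eta> * gap_integral 1 (- 1) \<eta> - l * (\<eta> * gap_integral 0 1 \<eta>)"
      by (simp only: right_diff_distrib mult.left_commute)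
    moreover have "\<eta> * gap_integral 1 (- 1) \<eta> \<le> 2 * pi"
      using gap_integral_critical_le[OF \<eta>(1)] \<eta> by (simp add: field_simps)
    moreover have "2 * pi + \<beta> / \<alpha> + 1 \<le> l * (\<eta> * gap_integral 0 1 \<eta>)"
      using elim l by (simp add: pos_divide_le_eq mult.commute)
    moreover define c where "c = \<beta> / \<alpha> + 1"
    ultimately have scaled: "\<eta> * gap_integral 1 (1 - 1 / b) \<eta> \<le> - c"
      by linarith
    have c: "c > 0"
      using \<alpha> \<beta> by (simp add: c_def add_nonneg_pos)
    then have "\<eta> * c \<le> 1 * c"
      using \<eta> by (intro mult_right_mono) auto
    then have "\<eta> * gap_integral 1 (1 - 1 / b) \<eta> \<le> \<eta> * (- c)"
      using scaled by simp
    then have neg: "gap_integral 1 (1 - 1 / b) \<eta> \<le> - c"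
      using \<eta> by (simp only: mult_le_cancel_left_pos)
    with c have "\<alpha> * sqrt (1 + \<eta>\<^sup>2) * gap_integral 1 (1 - 1 / b) \<eta>
        \<le> \<alpha> * 1 * gap_integral 1 (1 - 1 / b) \<eta>"
      using \<alpha> by (intro mult_right_mono_neg mult_left_mono) auto
    also have "\<dots> \<le> \<alpha> * 1 * (- c)"
      using neg \<alpha> by (intro mult_left_mono) auto
    also have "\<dots> = - \<beta> - \<alpha>"
      using \<alpha> by (simp add: c_def field_simps)
    finally have "\<alpha> * sqrt (1 + \<eta>\<^sup>2) * gap_integral 1 (1 - 1 / b) \<eta> \<le> - \<beta> - \<alpha>" .
    moreover have "\<beta> * b \<le> \<beta> * 1"
      using b \<beta> by (intro mult_left_mono) auto
    ultimately show ?case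
      using \<alpha> by linarith
  qed
  then show ?thesis
    using small by (rule eventually_compose_filterlim)
qed

text \<open>Intermediate value theorem in the radius: the scalar equation changes sign between \<open>b\<close> and
  \<open>1/2\<close>. Strict positivity at \<open>1/2\<close> keeps the zero away from the right endpoint.\<close>

lemma screw_stationary_near_half:
  assumes \<alpha>: "\<alpha> > 0" and \<beta>: "\<beta> \<ge> 0" and b: "0 < b" "b < 1 / 2"
  shows "\<forall>\<^sub>F w in at_top. \<exists>B\<in>{b..<1 / 2}. screw_stationary \<alpha> \<beta> B w"
  using scalar_equation_lhs_eventually_neg[OF b \<alpha> \<beta>] eventually_gt_at_top[of 0]
proof eventually_elim
  case (elim w)
  \<comment> \<open>The left-hand side of the scalar equation, split so that the two integrals depend on \<open>B\<close> only through \<open>\<eta>\<close>, in which they are continuous.\<close>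
  define \<Phi> where "\<Phi> B = \<alpha> * sqrt (1 + (1 / (w * B))\<^sup>2)
      * (gap_integral 1 (- 1) (1 / (w * B)) + (2 - 1 / B) * gap_integral 0 1 (1 / (w * B))) + \<beta> * B" for B
  have \<Phi>_eq: "\<Phi> B = \<alpha> * sqrt (1 + (1 / (w * B))\<^sup>2) * gap_integral 1 (1 - 1 / B) (1 / (w * B)) + \<beta> * B"
    if "B > 0" for B
    using gap_integral_split[of "1 / (w * B)" 1 "- 1" "2 - 1 / B"] that elim(2) by (simp add: \<Phi>_def)
  have "continuous_on {b..1 / 2} \<Phi>"
  proof -
    have eta: "continuous_on {b..1 / 2} (\<lambda>B. 1 / (w * B))"
      using b elim(2) by (intro continuous_intros) auto
    have gap: "continuous_on {b..1 / 2} (\<lambda>B. gap_integral x y (1 / (w * B)))" for x y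
      using b elim(2) by (intro continuous_on_compose2[OF continuous_on_gap_integral eta]) auto
    show ?thesis
      unfolding \<Phi>_def using b elim(2) by (intro continuous_intros gap eta) auto
  qed
  moreover have "\<Phi> b < 0"
    using elim(1) b by (simp add: \<Phi>_eq)
  moreover have pos: "0 < \<Phi> (1 / 2)"
  proof -
    have "0 < gap_integral 1 (- 1) (1 / (w * (1 / 2)))"
      using elim(2) by (intro gap_integral_critical_pos) simp
    then have "0 < \<alpha> * sqrt (1 + (1 / (w * (1 / 2)))\<^sup>2) * gap_integral 1 (- 1) (1 / (w * (1 / 2)))"
      using \<alpha> by (intro mult_pos_pos) (auto simp: add_pos_nonneg)
    then show ?thesis
      using \<beta> by (simp add: \<Phi>_def)
  qed
  ultimately obtain B where B: "b \<le> B" "B \<le> 1 / 2" "\<Phi> B = 0"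
    using b IVT'[of \<Phi> b 0 "1 / 2"] by auto
  then have "B \<noteq> 1 / 2"
    using pos by (metis less_irrefl)
  moreover have "screw_stationary \<alpha> \<beta> B w"
    using B b elim(2) \<Phi>_eq[of B] by (subst screw_stationary_iff) (auto simp: field_simps)
  ultimately show ?case
    using B by (intro bexI[of _ B]) auto
qed

text \<open>Passes from existence near \<open>c\<close>, with a threshold for \<open>i\<close> that depends on the precision, to one
  sequence converging to \<open>c\<close>: choose \<open>X i\<close> within \<open>1 / (i + 1)\<close> of the supremum of \<open>S i\<close>. Where
  \<open>S i\<close> is empty any value between \<open>a\<close> and \<open>c\<close> will do.\<close>

lemma exists_sequence_near_supremum:
  fixes S :: "nat \<Rightarrow> real set"
  assumes "a < c" and S: "\<And>i. S i \<subseteq> {a<..<c}"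
    and near: "\<And>b. a < b \<Longrightarrow> b < c \<Longrightarrow> \<forall>\<^sub>F i in sequentially. \<exists>x\<in>S i. b \<le> x"
  shows "\<exists>X. (\<forall>i. X i \<in> {a<..<c}) \<and> X \<longlonglongrightarrow> c \<and> (\<forall>\<^sub>F i in sequentially. X i \<in> S i)"
proof -
  have bdd: "bdd_above (S i)" for i
    using S[of i] by (intro bdd_aboveI[of _ c]) auto
  have "\<exists>x\<in>{a<..<c}. S i \<noteq> {} \<longrightarrow> x \<in> S i \<and> Sup (S i) - 1 / (real i + 1) < x" for i
  proof (cases "S i = {}")
    case True
    then show ?thesis
      using \<open>a < c\<close> dense[of a c] by auto
  next
    case False
    then obtain x where "x \<in> S i" "Sup (S i) - 1 / (real i + 1) < x"
      using less_cSup_iff[OF False bdd, of "Sup (S i) - 1 / (real i + 1)"] by auto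
    then show ?thesis
      using S[of i] by blast
  qed
  then obtain X where X: "\<And>i. X i \<in> {a<..<c}"
    "\<And>i. S i \<noteq> {} \<Longrightarrow> X i \<in> S i \<and> Sup (S i) - 1 / (real i + 1) < X i"
    by metis
  have "X \<longlonglongrightarrow> c"
  proof (rule order_tendstoI)
    fix y assume "c < y"
    have "X i < y" for i
      using X(1)[of i] \<open>c < y\<close> by auto
    then show "\<forall>\<^sub>F i in sequentially. X i < y"
      by simp
  next
    fix y assume "y < c"
    obtain y' where y': "max a y < y'" "y' < c"
      using dense[of "max a y" c] \<open>a < c\<close> \<open>y < c\<close> by auto
    have "(\<lambda>i. 1 / (real i + 1)) \<longlonglongrightarrow> 0"
      using LIMSEQ_inverse_real_of_nat by (simp add: inverse_eq_divide add.commute)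
    then have "\<forall>\<^sub>F i in sequentially. 1 / (real i + 1) < y' - y"
      using y' by (intro order_tendstoD(2)) auto
    moreover have "\<forall>\<^sub>F i in sequentially. \<exists>x\<in>S i. y' \<le> x"
      using near[of y'] y' by auto
    ultimately show "\<forall>\<^sub>F i in sequentially. y < X i"
    proof eventually_elim
      case (elim i)
      then have "y' \<le> Sup (S i)" and "S i \<noteq> {}"
        using cSup_upper[OF _ bdd] by force+
      then show ?case
        using X(2)[of i] elim by auto
    qed
  qed
  moreover have "\<forall>\<^sub>F i in sequentially. X i \<in> S i"
    using near[of "(a + c) / 2"] \<open>a < c\<close> X(2) by (auto elim!: eventually_mono)
  ultimately show ?thesis
    using X(1) by blast
qed

theorem theorem3p1:
  fixes \<alpha> \<beta> :: real and \<omega> :: "nat \<Rightarrow> real"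
  assumes "\<alpha> \<ge> 0" and "\<beta> \<ge> 0"
    and "\<alpha> = 0 \<Longrightarrow> \<beta> = 0"
    and "\<And>i. \<omega> i > 0"
    and "filterlim \<omega> at_top sequentially"
  shows "\<exists>B :: nat \<Rightarrow> real.
           (\<forall>i. 0 < B i \<and> B i < 1/2) \<and> B \<longlonglongrightarrow> 1/2 \<and>
           (\<forall>\<^sub>F i in sequentially. screw_stationary \<alpha> \<beta> (B i) (\<omega> i))"
proof -
  define S where "S i = {B \<in> {0<..<1 / 2}. screw_stationary \<alpha> \<beta> B (\<omega> i)}" for i
  have "\<forall>\<^sub>F i in sequentially. \<exists>x\<in>S i. b \<le> x" if b: "0 < b" "b < 1 / 2" for b
  proof (cases "\<alpha> = 0")
    case True
    \<comment> \<open>Then \<open>\<beta> = 0\<close> as well and every screw is stationary.\<close>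
    then have "screw_stationary \<alpha> \<beta> b w" for w
      using assms(3) by (simp add: screw_stationary_def mobius_plateau_stationary_def)
    then show ?thesis
      using b by (intro always_eventually allI bexI[of _ b]) (auto simp: S_def)
  next
    case False
    then have "\<forall>\<^sub>F w in at_top. \<exists>B\<in>{b..<1 / 2}. screw_stationary \<alpha> \<beta> B w"
      using assms(1,2) b by (intro screw_stationary_near_half) auto
    then have "\<forall>\<^sub>F i in sequentially. \<exists>B\<in>{b..<1 / 2}. screw_stationary \<alpha> \<beta> B (\<omega> i)"
      using assms(5) by (rule eventually_compose_filterlim)
    then show ?thesis
    proof eventually_elim
      case (elim i)
      then obtain x where "x \<in> {b..<1 / 2}" "screw_stationary \<alpha> \<beta> x (\<omega> i)"
        by blast
      then show ?case
        using b by (intro bexI[of _ x]) (auto simp: S_def)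
    qed
  qed
  moreover have sub: "S i \<subseteq> {0<..<1 / 2}" for i
    by (auto simp: S_def)
  ultimately obtain B where B: "\<And>i. B i \<in> {0<..<1 / 2}" "B \<longlonglongrightarrow> 1 / 2" "\<forall>\<^sub>F i in sequentially. B i \<in> S i"
    using exists_sequence_near_supremum[of 0 "1 / 2" S, OF _ sub] by auto
  have "\<forall>\<^sub>F i in sequentially. screw_stationary \<alpha> \<beta> (B i) (\<omega> i)"
    using B(3) by eventually_elim (simp add: S_def)
  then show ?thesis
    using B(1,2) by (intro exI[of _ B]) auto
qed

end
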